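(* Let $\exists X[F]$ be an $\exists$CNF formula (so $X\subseteq \mathrm{Vars}(F)$) and let $Z\subseteq X$. The variables of $Z$ are not redundant in $\exists X[F]$ if and only if there exist a set $W\subseteq Z$ and a $W$-boundary point of $F$ that is $X$-removable in $F$.
   Context: A clause is a disjunction of literals of Boolean variables; a CNF formula $F$ is a (finite) set of clauses, understood as their conjunction. $\mathrm{Vars}(\cdot)$ denotes the set of variables of a clause, formula or assignment. An $\exists$CNF formula is $\exists X[F]$ with $F$ a CNF formula and $X\subseteq \mathrm{Vars}(F)$; its free variables are $\mathrm{Vars}(F)\setminus X$, and $\equiv$ means equality of truth values under every complete assignment to the free variables. A clause $C$ is a $Z$-clause if $\mathrm{Vars}(C)\cap Z\neq\emptyset$; $F^Z$ is the set of all $Z$-clauses of $F$. The variables of $Z$ are redundant in $\exists X[F]$ if $\exists X[F]\equiv\exists X[F\setminus F^Z]$. A point of $F$ is an assignment $p$ with $\mathrm{Vars}(F)\subseteq\mathrm{Vars}(p)$. A point $p$ is a $Z$-boundary point of $F$ if (a) $Z\ne\emptyset$; (b) $p$ falsifies $F$; (c) every clause of $F$ falsified by $p$ is a $Z$-clause; (d) condition (c) fails for every proper subset of $Z$. A $Z$-boundary point $p$ of $F$ is $X$-removable in $F$ if $Z\subseteq X\subseteq\mathrm{Vars}(F)$ and there is a clause $C$ such that $F\Rightarrow C$, $p$ falsifies $C$, and $\mathrm{Vars}(C)\cap X=\emptyset$. *)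

theory Defs
  imports Main
begin

datatype 'v literal = Pos (atom: 'v) | Neg (atom: 'v)

type_synonym 'v clause = "'v literal set"
type_synonym 'v formula = "'v clause set"
type_synonym 'v assignment = "'v \<rightharpoonup> bool"

definition is_clause :: "'v clause \<Rightarrow> bool" where
  "is_clause C \<longleftrightarrow> finite C"

definition is_cnf :: "'v formula \<Rightarrow> bool" where
  "is_cnf F \<longleftrightarrow> finite F \<and> (\<forall>C\<in>F. is_clause C)"

definition clause_vars :: "'v clause \<Rightarrow> 'v set" where
  "clause_vars C = atom ` C"

definition vars :: "'v formula \<Rightarrow> 'v set" where
  "vars F = (\<Union>C\<in>F. clause_vars C)"

fun lit_val :: "'v assignment \<Rightarrow> 'v literal \<Rightarrow> bool option" where
  "lit_val p (Pos v) = p v"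
| "lit_val p (Neg v) = map_option Not (p v)"

text \<open>Assignments are partial, so falsifying is not the negation of satisfying
  unless all variables involved are assigned.\<close>

definition satisfies_clause :: "'v assignment \<Rightarrow> 'v clause \<Rightarrow> bool" where
  "satisfies_clause p C \<longleftrightarrow> (\<exists>l\<in>C. lit_val p l = Some True)"

definition falsifies_clause :: "'v assignment \<Rightarrow> 'v clause \<Rightarrow> bool" where
  "falsifies_clause p C \<longleftrightarrow> (\<forall>l\<in>C. lit_val p l = Some False)"

definition satisfies :: "'v assignment \<Rightarrow> 'v formula \<Rightarrow> bool" where
  "satisfies p F \<longleftrightarrow> (\<forall>C\<in>F. satisfies_clause p C)"

definition falsifies :: "'v assignment \<Rightarrow> 'v formula \<Rightarrow> bool" where
  "falsifies p F \<longleftrightarrow> (\<exists>C\<in>F. falsifies_clause p C)"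

definition implies_clause :: "'v formula \<Rightarrow> 'v clause \<Rightarrow> bool" where
  "implies_clause F C \<longleftrightarrow>
     (\<forall>p. vars F \<union> clause_vars C \<subseteq> dom p \<longrightarrow> satisfies p F \<longrightarrow> satisfies_clause p C)"

text \<open>The pair \<open>X\<close>, \<open>F\<close> represents \<open>\<exists>X[F]\<close>.\<close>

definition is_ecnf :: "'v set \<Rightarrow> 'v formula \<Rightarrow> bool" where
  "is_ecnf X F \<longleftrightarrow> is_cnf F \<and> X \<subseteq> vars F"

definition free_vars :: "'v set \<Rightarrow> 'v formula \<Rightarrow> 'v set" where
  "free_vars X F = vars F - X"

definition ecnf_true :: "'v assignment \<Rightarrow> 'v set \<Rightarrow> 'v formula \<Rightarrow> bool" where
  "ecnf_true y X F \<longleftrightarrow> (\<exists>x. dom x = X \<and> satisfies (y ++ x) F)"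

text \<open>Deleting clauses may remove variables, so the two sides can have different free
  variables; they are compared under assignments to all of them. Likewise, a quantified
  variable that no longer occurs in the formula is quantified vacuously.\<close>

definition ecnf_equiv :: "'v set \<Rightarrow> 'v formula \<Rightarrow> 'v set \<Rightarrow> 'v formula \<Rightarrow> bool" where
  "ecnf_equiv X F Y G \<longleftrightarrow>
     (\<forall>y. dom y = free_vars X F \<union> free_vars Y G \<longrightarrow> ecnf_true y X F = ecnf_true y Y G)"

definition is_Z_clause :: "'v set \<Rightarrow> 'v clause \<Rightarrow> bool" where
  "is_Z_clause Z C \<longleftrightarrow> clause_vars C \<inter> Z \<noteq> {}"

definition Z_clauses :: "'v set \<Rightarrow> 'v formula \<Rightarrow> 'v formula" where
  "Z_clauses Z F = {C \<in> F. is_Z_clause Z C}"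

definition redundant :: "'v set \<Rightarrow> 'v set \<Rightarrow> 'v formula \<Rightarrow> bool" where
  "redundant Z X F \<longleftrightarrow> ecnf_equiv X F X (F - Z_clauses Z F)"

definition is_point :: "'v formula \<Rightarrow> 'v assignment \<Rightarrow> bool" where
  "is_point F p \<longleftrightarrow> vars F \<subseteq> dom p"

definition falsified_are_Z_clauses :: "'v formula \<Rightarrow> 'v set \<Rightarrow> 'v assignment \<Rightarrow> bool" where
  "falsified_are_Z_clauses F Z p \<longleftrightarrow> (\<forall>C\<in>F. falsifies_clause p C \<longrightarrow> is_Z_clause Z C)"

definition boundary_point :: "'v formula \<Rightarrow> 'v set \<Rightarrow> 'v assignment \<Rightarrow> bool" where
  "boundary_point F Z p \<longleftrightarrow>
     is_point F p \<and> Z \<noteq> {} \<and> falsifies p F \<and> falsified_are_Z_clauses F Z p \<and>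
     (\<forall>Z'. Z' \<subset> Z \<longrightarrow> \<not> falsified_are_Z_clauses F Z' p)"

definition removable :: "'v set \<Rightarrow> 'v formula \<Rightarrow> 'v set \<Rightarrow> 'v assignment \<Rightarrow> bool" where
  "removable X F Z p \<longleftrightarrow>
     boundary_point F Z p \<and> Z \<subseteq> X \<and> X \<subseteq> vars F \<and>
     (\<exists>C. is_clause C \<and> implies_clause F C \<and> falsifies_clause p C \<and> clause_vars C \<inter> X = {})"

end

theory Submission
  imports Defs
begin

text \<open>If \<open>Z\<close> is not redundant, some assignment \<open>y\<close> to the free variables makes
  \<open>\<exists>X[F]\<close> false but extends to a point \<open>p\<close> satisfying \<open>F \<setminus> F\<^sup>Z\<close>. Then every clause falsified by
  \<open>p\<close> is a \<open>Z\<close>-clause, a minimal \<open>W \<subseteq> Z\<close> with this property makes \<open>p\<close> a \<open>W\<close>-boundary point, and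
  the longest clause falsified by \<open>y\<close> witnesses removability. Conversely, the free part of an
  \<open>X\<close>-removable point extends to satisfy \<open>F \<setminus> F\<^sup>Z\<close> but, because of the removing clause,
  not to satisfy \<open>F\<close>.\<close>

section \<open>Evaluation of literals, clauses and formulas under partial assignments\<close>

lemma lit_val_eq_None_iff: "lit_val p l = None \<longleftrightarrow> atom l \<notin> dom p"
  by (cases l) auto

lemma lit_val_cong: "p (atom l) = q (atom l) \<Longrightarrow> lit_val p l = lit_val q l"
  by (cases l) auto

lemma satisfies_clause_cong:
  assumes "\<And>v. v \<in> clause_vars C \<Longrightarrow> p v = q v"
  shows "satisfies_clause p C \<longleftrightarrow> satisfies_clause q C"
proof -
  have "lit_val p l = lit_val q l" if "l \<in> C" for l
    using assms that by (intro lit_val_cong) (auto simp: clause_vars_def)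
  then show ?thesis
    by (auto simp: satisfies_clause_def)
qed

lemma falsifies_clause_cong:
  assumes "\<And>v. v \<in> clause_vars C \<Longrightarrow> p v = q v"
  shows "falsifies_clause p C \<longleftrightarrow> falsifies_clause q C"
proof -
  have "lit_val p l = lit_val q l" if "l \<in> C" for l
    using assms that by (intro lit_val_cong) (auto simp: clause_vars_def)
  then show ?thesis
    by (auto simp: falsifies_clause_def)
qed

lemma clause_vars_subset_vars: "C \<in> F \<Longrightarrow> clause_vars C \<subseteq> vars F"
  by (auto simp: vars_def)

lemma vars_mono: "G \<subseteq> F \<Longrightarrow> vars G \<subseteq> vars F"
  by (auto simp: vars_def)

lemma satisfies_cong:
  assumes "\<And>v. v \<in> vars F \<Longrightarrow> p v = q v"
  shows "satisfies p F \<longleftrightarrow> satisfies q F"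
proof -
  have "satisfies_clause p C \<longleftrightarrow> satisfies_clause q C" if "C \<in> F" for C
    using assms clause_vars_subset_vars[OF that] by (intro satisfies_clause_cong) auto
  then show ?thesis
    by (auto simp: satisfies_def)
qed

lemma falsifies_clause_imp_vars_assigned:
  assumes "falsifies_clause p C"
  shows "clause_vars C \<subseteq> dom p"
proof -
  have "atom l \<in> dom p" if "l \<in> C" for l
    using assms that lit_val_eq_None_iff[of p l] by (auto simp: falsifies_clause_def)
  then show ?thesis
    by (auto simp: clause_vars_def)
qed

lemma not_satisfies_and_falsifies: "falsifies_clause p C \<Longrightarrow> \<not> satisfies_clause p C"
  by (auto simp: satisfies_clause_def falsifies_clause_def)

text \<open>Only an unassigned atom can give a literal the value \<open>None\<close>, and that is
  the only way for a clause to be neither satisfied nor falsified.\<close>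

lemma satisfies_clause_or_falsifies:
  assumes "clause_vars C \<subseteq> dom p"
  shows "satisfies_clause p C \<or> falsifies_clause p C"
proof -
  have "lit_val p l = Some True \<or> lit_val p l = Some False" if "l \<in> C" for l
  proof -
    have "atom l \<in> dom p"
      using assms that by (auto simp: clause_vars_def)
    then show ?thesis
      using lit_val_eq_None_iff[of p l] by (cases "lit_val p l") auto
  qed
  then show ?thesis
    by (auto simp: satisfies_clause_def falsifies_clause_def)
qed

lemma finite_vars: "is_cnf F \<Longrightarrow> finite (vars F)"
  by (auto simp: is_cnf_def is_clause_def vars_def clause_vars_def)

section \<open>Failure of redundancy\<close>

lemma ecnf_true_mono: "G \<subseteq> F \<Longrightarrow> ecnf_true y X F \<Longrightarrow> ecnf_true y X G"
  by (auto simp: ecnf_true_def satisfies_def)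

text \<open>Deleting clauses creates no new free variables, so the assignments to compare are those
  to \<open>free_vars X F\<close>. Deletion also only weakens a formula, so the truth values can
  differ in one direction only.\<close>

lemma not_redundant_iff:
  "\<not> redundant Z X F \<longleftrightarrow>
    (\<exists>y. dom y = free_vars X F \<and> ecnf_true y X (F - Z_clauses Z F) \<and> \<not> ecnf_true y X F)"
proof -
  have "free_vars X F \<union> free_vars X (F - Z_clauses Z F) = free_vars X F"
    using vars_mono[of "F - Z_clauses Z F" F] by (auto simp: free_vars_def)
  then show ?thesis
    using ecnf_true_mono[of "F - Z_clauses Z F" F]
    by (auto simp: redundant_def ecnf_equiv_def)
qed

section \<open>The clause that excludes a given assignment\<close>

text \<open>The longest clause falsified by \<open>y\<close>, that is, the negation of
  \<open>y\<close> read as a conjunction of literals. Unassigned variables contribute nothing, since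
  their literals evaluate to \<open>None\<close>.\<close>

definition blocking_clause :: "'v assignment \<Rightarrow> 'v clause" where
  "blocking_clause y = {l. lit_val y l = Some False}"

lemma falsifies_blocking_clause: "falsifies_clause y (blocking_clause y)"
  by (auto simp: falsifies_clause_def blocking_clause_def)

text \<open>Each assigned variable contributes exactly one literal. In this form both finiteness and
  the set of variables can be read off.\<close>

lemma blocking_clause_eq:
  "blocking_clause y = (\<lambda>v. if y v = Some True then Neg v else Pos v) ` dom y"
proof (intro set_eqI iffI)
  fix l
  assume "l \<in> blocking_clause y"
  then show "l \<in> (\<lambda>v. if y v = Some True then Neg v else Pos v) ` dom y"
    by (cases l) (auto simp: blocking_clause_def image_iff intro: bexI[of _ "atom l"])
next
  fix l
  assume "l \<in> (\<lambda>v. if y v = Some True then Neg v else Pos v) ` dom y"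
  then show "l \<in> blocking_clause y"
    by (auto simp: blocking_clause_def)
qed

lemma clause_vars_blocking_clause: "clause_vars (blocking_clause y) = dom y"
proof -
  have "atom (if y v = Some True then Neg v else Pos v) = v" for v
    by simp
  then show ?thesis
    unfolding clause_vars_def blocking_clause_eq image_image by simp
qed

lemma is_clause_blocking_clause: "finite (dom y) \<Longrightarrow> is_clause (blocking_clause y)"
  by (simp add: is_clause_def blocking_clause_eq)

lemma falsifies_blocking_clause_imp_agree:
  assumes "falsifies_clause q (blocking_clause y)" and "v \<in> dom y"
  shows "q v = y v"
proof -
  obtain b where b: "y v = Some b"
    using assms(2) by auto
  then have "(if b then Neg v else Pos v) \<in> blocking_clause y"
    by (auto simp: blocking_clause_def)
  with assms(1) have "lit_val q (if b then Neg v else Pos v) = Some False"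
    by (auto simp: falsifies_clause_def)
  then show ?thesis
    using b by (auto split: if_splits)
qed

text \<open>A model \<open>q\<close> of \<open>F\<close> that falsified the clause would agree with
  \<open>y\<close> on all free variables. Its restriction to \<open>X\<close> would then witness
  that the quantified formula is true under \<open>y\<close>.\<close>

lemma implies_blocking_clause:
  assumes "dom y = free_vars X F" and "X \<subseteq> vars F" and "\<not> ecnf_true y X F"
  shows "implies_clause F (blocking_clause y)"
  unfolding implies_clause_def
proof (intro allI impI)
  fix q
  assume dom_q: "vars F \<union> clause_vars (blocking_clause y) \<subseteq> dom q" and sat: "satisfies q F"
  show "satisfies_clause q (blocking_clause y)"
  proof (rule ccontr)
    assume "\<not> satisfies_clause q (blocking_clause y)"
    then have "falsifies_clause q (blocking_clause y)"
      using satisfies_clause_or_falsifies[of "blocking_clause y" q] dom_q by simp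
    then have agree: "q v = y v" if "v \<in> dom y" for v
      using that falsifies_blocking_clause_imp_agree by metis
    have "(y ++ q |` X) v = q v" if "v \<in> vars F" for v
    proof (cases "v \<in> X")
      case True
      then have "v \<in> dom (q |` X)"
        using dom_q that by auto
      with True show ?thesis
        by (simp add: map_add_dom_app_simps)
    next
      case False
      then show ?thesis
        using agree that assms(1) by (simp add: free_vars_def map_add_dom_app_simps)
    qed
    then have "satisfies (y ++ q |` X) F"
      using sat satisfies_cong by metis
    moreover have "dom (q |` X) = X"
      using dom_q assms(2) by auto
    ultimately show False
      using assms(3) by (auto simp: ecnf_true_def)
  qed
qed

section \<open>Construction of a removable boundary point\<close>

text \<open>As \<open>Z\<close> is finite, its subsets that meet every clause falsified by
  \<open>p\<close> include an inclusion-minimal one, and minimality is condition (d).\<close>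

lemma boundary_point_exists:
  assumes "finite Z" and "is_point F p" and "falsifies p F" and "falsified_are_Z_clauses F Z p"
  obtains W where "W \<subseteq> Z" and "boundary_point F W p"
proof -
  let ?S = "{W. W \<subseteq> Z \<and> falsified_are_Z_clauses F W p}"
  have "finite ?S" and "?S \<noteq> {}"
    using assms by auto
  from finite_has_minimal[OF this]
  obtain W where W: "W \<in> ?S" and min: "\<forall>V\<in>?S. V \<subseteq> W \<longrightarrow> W = V" ..
  \<comment> \<open>Some clause of \<open>F\<close> is falsified, and it must share a variable with
    \<open>W\<close>.\<close>
  have "W \<noteq> {}"
    using W assms(3) by (auto simp: falsifies_def falsified_are_Z_clauses_def is_Z_clause_def)
  moreover have "\<not> falsified_are_Z_clauses F V p" if "V \<subset> W" for V
    using min W that by blast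
  ultimately have "boundary_point F W p"
    using W assms by (auto simp: boundary_point_def)
  with W that show thesis
    by auto
qed

lemma removable_point_exists:
  assumes "is_ecnf X F" and "Z \<subseteq> X" and y: "dom y = free_vars X F"
    and "ecnf_true y X (F - Z_clauses Z F)" and false: "\<not> ecnf_true y X F"
  shows "\<exists>W p. W \<subseteq> Z \<and> boundary_point F W p \<and> removable X F W p"
proof -
  have cnf: "is_cnf F" and X: "X \<subseteq> vars F"
    using assms(1) by (auto simp: is_ecnf_def)
  obtain x where x: "dom x = X" and sat: "satisfies (y ++ x) (F - Z_clauses Z F)"
    using assms(4) by (auto simp: ecnf_true_def)
  let ?p = "y ++ x"
  have point: "is_point F ?p"
    using x y by (auto simp: is_point_def free_vars_def)
  have "\<not> satisfies ?p F"
    using false x by (auto simp: ecnf_true_def)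
  then obtain D where D: "D \<in> F" "\<not> satisfies_clause ?p D"
    by (auto simp: satisfies_def)
  have "clause_vars D \<subseteq> dom ?p"
    using point clause_vars_subset_vars[OF D(1)] unfolding is_point_def by (rule subset_trans[rotated])
  then have "falsifies_clause ?p D"
    using satisfies_clause_or_falsifies D(2) by metis
  with D(1) have "falsifies ?p F"
    unfolding falsifies_def by (rule bexI[rotated])
  \<comment> \<open>All clauses outside \<open>Z_clauses Z F\<close> are satisfied by the choice of
    \<open>x\<close>, hence not falsified.\<close>
  moreover have "falsified_are_Z_clauses F Z ?p"
    using sat not_satisfies_and_falsifies
    by (auto simp: falsified_are_Z_clauses_def satisfies_def Z_clauses_def)
  moreover have "finite Z"
    using finite_vars[OF cnf] X assms(2) by (meson finite_subset)
  ultimately obtain W where W: "W \<subseteq> Z" and bp: "boundary_point F W ?p"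
    using boundary_point_exists point by metis
  have disjoint: "dom y \<inter> X = {}"
    using y by (auto simp: free_vars_def)
  \<comment> \<open>The operator \<open>++\<close> prefers \<open>x\<close>, but \<open>x\<close> is
    defined on \<open>X\<close> only, so it overrides no value of \<open>y\<close>.\<close>
  have "falsifies_clause ?p (blocking_clause y) \<longleftrightarrow> falsifies_clause y (blocking_clause y)"
    using disjoint x
    by (intro falsifies_clause_cong) (auto simp: clause_vars_blocking_clause map_add_def split: option.splits)
  moreover have "finite (dom y)"
    using finite_vars[OF cnf] y by (simp add: free_vars_def)
  ultimately have "removable X F W ?p"
    unfolding removable_def
    using bp W assms(2) X disjoint implies_blocking_clause[OF y X false]
      falsifies_blocking_clause[of y] is_clause_blocking_clause[of y] clause_vars_blocking_clause[of y]
    by blast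
  with W bp show ?thesis
    by blast
qed

section \<open>From a removable point back to non-redundancy\<close>

lemma not_redundant_of_removable:
  assumes "W \<subseteq> Z" and "removable X F W p"
  shows "\<not> redundant Z X F"
proof -
  have bp: "boundary_point F W p" and X: "X \<subseteq> vars F"
    using assms(2) by (auto simp: removable_def)
  obtain C where C: "implies_clause F C" "falsifies_clause p C" "clause_vars C \<inter> X = {}"
    using assms(2) by (auto simp: removable_def)
  have point: "vars F \<subseteq> dom p"
    using bp by (simp add: boundary_point_def is_point_def)
  let ?G = "F - Z_clauses Z F"
  let ?y = "p |` free_vars X F"
  have dom_y: "dom ?y = free_vars X F"
    using point by (auto simp: free_vars_def)
  have "satisfies_clause p D" if "D \<in> ?G" for D
  proof -
    \<comment> \<open>This is where \<open>W \<subseteq> Z\<close> enters: a clause that avoids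
      \<open>Z\<close> avoids \<open>W\<close> too, so the boundary point cannot falsify it.\<close>
    have "\<not> is_Z_clause W D"
      using that assms(1) by (auto simp: Z_clauses_def is_Z_clause_def)
    then have "\<not> falsifies_clause p D"
      using that bp by (auto simp: boundary_point_def falsified_are_Z_clauses_def)
    moreover have "clause_vars D \<subseteq> dom p"
      using that point clause_vars_subset_vars by blast
    ultimately show ?thesis
      using satisfies_clause_or_falsifies[of D p] by simp
  qed
  then have "satisfies p ?G"
    by (simp add: satisfies_def)
  moreover have "(?y ++ p |` X) v = p v" if "v \<in> vars ?G" for v
    using that vars_mono[of ?G F]
    by (auto simp: free_vars_def map_add_def restrict_map_def split: option.splits)
  ultimately have "satisfies (?y ++ p |` X) ?G"
    using satisfies_cong by metis
  moreover have "dom (p |` X) = X"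
    using point X by auto
  ultimately have "ecnf_true ?y X ?G"
    unfolding ecnf_true_def by (intro exI[of _ "p |` X"] conjI)
  moreover have "\<not> ecnf_true ?y X F"
  proof
    assume "ecnf_true ?y X F"
    then obtain x where x: "dom x = X" and sat: "satisfies (?y ++ x) F"
      by (auto simp: ecnf_true_def)
    \<comment> \<open>The clause \<open>C\<close> may contain variables that do not occur in
      \<open>F\<close>. Implication is tested only on assignments that cover them, so
      \<open>?y\<close> is replaced by the larger assignment \<open>p\<close>.\<close>
    have "(p ++ x) v = (?y ++ x) v" if "v \<in> vars F" for v
      using that x
      by (auto simp: free_vars_def map_add_def restrict_map_def split: option.splits)
    then have "satisfies (p ++ x) F"
      using sat satisfies_cong by metis
    moreover have "vars F \<union> clause_vars C \<subseteq> dom (p ++ x)"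
      using point falsifies_clause_imp_vars_assigned[OF C(2)] by auto
    ultimately have "satisfies_clause (p ++ x) C"
      using C(1) by (auto simp: implies_clause_def)
    \<comment> \<open>Adding \<open>x\<close> changes \<open>p\<close> on \<open>X\<close> only, and
      \<open>C\<close> has no variable in \<open>X\<close>.\<close>
    moreover have "falsifies_clause (p ++ x) C \<longleftrightarrow> falsifies_clause p C"
      using C(3) x by (intro falsifies_clause_cong) (auto simp: map_add_def split: option.splits)
    ultimately show False
      using C(2) not_satisfies_and_falsifies by blast
  qed
  ultimately show ?thesis
    unfolding not_redundant_iff using dom_y by (intro exI[of _ ?y] conjI)
qed

theorem proposition2:
  fixes F :: "'v formula" and X Z :: "'v set"
  assumes "is_ecnf X F" and "Z \<subseteq> X"
  shows "\<not> redundant Z X F \<longleftrightarrow>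
    (\<exists>W p. W \<subseteq> Z \<and> boundary_point F W p \<and> removable X F W p)"
proof
  assume "\<not> redundant Z X F"
  then obtain y where "dom y = free_vars X F" "ecnf_true y X (F - Z_clauses Z F)" "\<not> ecnf_true y X F"
    unfolding not_redundant_iff by (elim exE conjE)
  then show "\<exists>W p. W \<subseteq> Z \<and> boundary_point F W p \<and> removable X F W p"
    by (rule removable_point_exists[OF assms])
next
  assume "\<exists>W p. W \<subseteq> Z \<and> boundary_point F W p \<and> removable X F W p"
  then show "\<not> redundant Z X F"
    by (elim exE conjE) (rule not_redundant_of_removable)
qed

end
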